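(* Equicontinuity and sensitivity to the initial conditions are decidable for additive cellular automata over a finite abelian group. That is, there is an algorithm which, given a finite abelian group $G$, a radius $r\in\mathbb{N}$ and the local rule $\delta:G^{2r+1}\to G$ of an additive cellular automaton $F$ over $G$, decides whether $F$ is equicontinuous; and there is likewise an algorithm which decides whether $F$ is sensitive to the initial conditions.
   Context: $\mathbb{N}=\{0,1,2,\ldots\}$. For a finite set $S$, the configuration space $S^{\mathbb{Z}}$ is the set of maps $c:\mathbb{Z}\to S$, $i\mapsto c_i$, equipped with the distance $d(c,c')=2^{-\ell}$, where $\ell=\min\{i\in\mathbb{N}: c_i\ne c'_i\text{ or }c_{-i}\neq c'_{-i}\}$ (and $d(c,c)=0$). A (one-dimensional) cellular automaton with local rule $\delta:S^{2r+1}\to S$ of radius $r\in\mathbb{N}$ is the map $F:S^{\mathbb{Z}}\to S^{\mathbb{Z}}$, $F(c)_i=\delta(c_{i-r},\ldots,c_{i+r})$. An additive cellular automaton over a finite abelian group $G$ is a cellular automaton $F:G^{\mathbb{Z}}\to G^{\mathbb{Z}}$ that is an endomorphism of the (componentwise) group $G^{\mathbb{Z}}$. Equivalently, its local rule has the form $\delta(x_{-r},\ldots,x_r)=\sum_{i=-r}^r\delta_i(x_i)$ with each $\delta_i$ an endomorphism of $G$. Let $F:\mathcal{X}\to\mathcal{X}$ be a continuous self-map of a metric space $(\mathcal{X},d)$. $F$ is sensitive to the initial conditions if there exists $\varepsilon>0$ such that for any $x\in\mathcal{X}$ and any $\delta>0$ there is $y\in\mathcal{X}$ with $0<d(y,x)<\delta$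 and $d(F^k(y),F^k(x))>\varepsilon$ for some $k\in\mathbb{N}$. $F$ is equicontinuous if for every $\varepsilon>0$ there is $\delta>0$ such that for all $x,y\in\mathcal{X}$, $d(x,y)<\delta$ implies $d(F^k(x),F^k(y))<\varepsilon$ for all $k\in\mathbb{N}$. *)

theory Defs
  imports "HOL-Algebra.Product_Groups" "HOL-Library.Nat_Bijection" Complex_Main
begin

definition configs :: "'a set \<Rightarrow> (int \<Rightarrow> 'a) set" where
  "configs S = (\<Pi>\<^sub>E i\<in>UNIV. S)"

definition config_dist :: "(int \<Rightarrow> 'a) \<Rightarrow> (int \<Rightarrow> 'a) \<Rightarrow> real" where
  "config_dist c c' =
     (if c = c' then 0
      else (1 / 2) ^ (LEAST i::nat. c (int i) \<noteq> c' (int i) \<or> c (- int i) \<noteq> c' (- int i)))"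

text \<open>
  An element of \<open>S\<^sup>2\<^sup>r\<^sup>+\<^sup>1\<close> is a list of length \<open>2 * r + 1\<close> over \<open>S\<close>; the values of a local rule
  on other lists are irrelevant.
\<close>

definition local_rules :: "'a set \<Rightarrow> nat \<Rightarrow> ('a list \<Rightarrow> 'a) set" where
  "local_rules S r = {xs. set xs \<subseteq> S \<and> length xs = 2 * r + 1} \<rightarrow> S"

definition ca_map :: "nat \<Rightarrow> ('a list \<Rightarrow> 'a) \<Rightarrow> (int \<Rightarrow> 'a) \<Rightarrow> (int \<Rightarrow> 'a)" where
  "ca_map r \<delta> c = (\<lambda>i. \<delta> (map c [i - int r..i + int r]))"

definition config_group :: "('a, 'b) monoid_scheme \<Rightarrow> (int \<Rightarrow> 'a) monoid" where
  "config_group G = product_group UNIV (\<lambda>_. G)"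

lemma carrier_config_group: "carrier (config_group G) = configs (carrier G)"
  by (simp add: config_group_def configs_def)

definition additive_ca :: "('a, 'b) monoid_scheme \<Rightarrow> nat \<Rightarrow> ('a list \<Rightarrow> 'a) \<Rightarrow> bool" where
  "additive_ca G r \<delta> \<longleftrightarrow>
     comm_group G \<and> finite (carrier G) \<and> \<delta> \<in> local_rules (carrier G) r \<and>
     ca_map r \<delta> \<in> hom (config_group G) (config_group G)"

definition sensitive :: "'x set \<Rightarrow> ('x \<Rightarrow> 'x \<Rightarrow> real) \<Rightarrow> ('x \<Rightarrow> 'x) \<Rightarrow> bool" where
  "sensitive X d F \<longleftrightarrow>
     (\<exists>\<epsilon>>0. \<forall>x\<in>X. \<forall>\<eta>>0. \<exists>y\<in>X. 0 < d y x \<and> d y x < \<eta> \<and>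
        (\<exists>k. d ((F ^^ k) y) ((F ^^ k) x) > \<epsilon>))"

definition equicontinuous :: "'x set \<Rightarrow> ('x \<Rightarrow> 'x \<Rightarrow> real) \<Rightarrow> ('x \<Rightarrow> 'x) \<Rightarrow> bool" where
  "equicontinuous X d F \<longleftrightarrow>
     (\<forall>\<epsilon>>0. \<exists>\<eta>>0. \<forall>x\<in>X. \<forall>y\<in>X. d x y < \<eta> \<longrightarrow>
        (\<forall>k. d ((F ^^ k) x) ((F ^^ k) y) < \<epsilon>))"

text \<open>
  Partial recursive functions. Arities are not part of the syntax: a term denotes one partial function for every length of
  the argument list. Primitive recursion and minimisation act on the first argument, and the step
  function of a primitive recursion receives the counter, then the previous value, then the
  parameters.
\<close>

datatype recf = Zero | Succ | Proj nat | Comp recf "recf list" | PrimRec recf recf | Mu recf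

inductive rec_eval :: "recf \<Rightarrow> nat list \<Rightarrow> nat \<Rightarrow> bool" where
  Zero: "rec_eval Zero xs 0"
| Succ: "rec_eval Succ [x] (Suc x)"
| Proj: "i < length xs \<Longrightarrow> rec_eval (Proj i) xs (xs ! i)"
| Comp: "list_all2 (\<lambda>g y. rec_eval g xs y) gs ys \<Longrightarrow> rec_eval f ys z \<Longrightarrow>
    rec_eval (Comp f gs) xs z"
| PrimRec_0: "rec_eval f xs y \<Longrightarrow> rec_eval (PrimRec f g) (0 # xs) y"
| PrimRec_Suc: "rec_eval (PrimRec f g) (n # xs) y \<Longrightarrow> rec_eval g (n # y # xs) z \<Longrightarrow>
    rec_eval (PrimRec f g) (Suc n # xs) z"
| Mu: "rec_eval f (n # xs) 0 \<Longrightarrow> (\<And>m. m < n \<Longrightarrow> \<exists>y>0. rec_eval f (m # xs) y) \<Longrightarrow>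
    rec_eval (Mu f) xs n"

inductive_cases rec_eval_ZeroE: "rec_eval Zero xs z"
inductive_cases rec_eval_SuccE: "rec_eval Succ xs z"
inductive_cases rec_eval_ProjE: "rec_eval (Proj i) xs z"
inductive_cases rec_eval_CompE: "rec_eval (Comp f gs) xs z"
inductive_cases rec_eval_PrimRec_0E: "rec_eval (PrimRec f g) (0 # xs) z"
inductive_cases rec_eval_PrimRec_SucE: "rec_eval (PrimRec f g) (Suc n # xs) z"
inductive_cases rec_eval_MuE: "rec_eval (Mu f) xs z"

lemma rec_eval_deterministic: "rec_eval f xs y \<Longrightarrow> rec_eval f xs z \<Longrightarrow> y = z"
proof (induction f xs y arbitrary: z rule: rec_eval.induct)
  case (Zero xs)
  then show ?case by (rule rec_eval_ZeroE) simp
next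
  case (Succ x)
  then show ?case by (rule rec_eval_SuccE) simp
next
  case (Proj i xs)
  from Proj.prems show ?case by (rule rec_eval_ProjE) simp
next
  case (Comp xs gs ys f z')
  from Comp.prems obtain ys' where
    ys': "list_all2 (\<lambda>g y. rec_eval g xs y) gs ys'" "rec_eval f ys' z"
    by (rule rec_eval_CompE)
  have "ys = ys'"
  proof (rule nth_equalityI)
    show "length ys = length ys'"
      using list_all2_lengthD[OF Comp.IH(1)] list_all2_lengthD[OF ys'(1)] by (rule trans[OF sym])
    show "ys ! i = ys' ! i" if "i < length ys" for i
    proof -
      have i: "i < length gs" using that list_all2_lengthD[OF Comp.IH(1)] by linarith
      show ?thesis
        using list_all2_nthD[OF Comp.IH(1) i] list_all2_nthD[OF ys'(1) i] by blast
    qed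
  qed
  then have "rec_eval f ys z" using ys'(2) by (rule ssubst)
  then show ?case by (rule Comp.IH(2))
next
  case (PrimRec_0 f xs y g)
  from PrimRec_0.prems have "rec_eval f xs z" by (rule rec_eval_PrimRec_0E)
  then show ?case by (rule PrimRec_0.IH)
next
  case (PrimRec_Suc f g n xs y z')
  from PrimRec_Suc.prems obtain y' where
    y': "rec_eval (PrimRec f g) (n # xs) y'" "rec_eval g (n # y' # xs) z"
    by (rule rec_eval_PrimRec_SucE)
  from y'(1) have "y = y'" by (rule PrimRec_Suc.IH(1))
  then have "rec_eval g (n # y # xs) z" using y'(2) by (rule ssubst)
  then show ?case by (rule PrimRec_Suc.IH(2))
next
  case (Mu f n xs)
  from Mu.prems have z0: "rec_eval f (z # xs) 0" by (rule rec_eval_MuE)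
  from Mu.prems have zm: "\<exists>y>0. rec_eval f (m # xs) y" if "m < z" for m
    by (rule rec_eval_MuE) (use that in blast)
  show ?case
  proof (rule linorder_cases[of n z])
    assume "n < z"
    then obtain y where "y > 0" "rec_eval f (n # xs) y" using zm by blast
    with Mu.IH(1)[of y] show ?thesis by linarith
  next
    assume "z < n"
    then obtain y where "y > 0" and y: "\<And>v. rec_eval f (z # xs) v \<Longrightarrow> y = v"
      using Mu.IH(2)[of z] by blast
    with y[OF z0] show ?thesis by linarith
  qed
qed

text \<open>
  \<open>D\<close> is the set of admissible inputs of the decision problem \<open>P\<close>. The algorithm has to halt with
  the correct answer on (the encoding of) every admissible input; nothing is required of it on
  other inputs.
\<close>

definition decidable_on :: "'i set \<Rightarrow> ('i \<Rightarrow> nat list) \<Rightarrow> ('i \<Rightarrow> bool) \<Rightarrow> bool" where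
  "decidable_on D enc P \<longleftrightarrow> (\<exists>f. \<forall>x\<in>D. rec_eval f (enc x) (if P x then 1 else 0))"

text \<open>
  To be an input of an algorithm, a group of order \<open>n\<close> has its elements numbered
  \<open>0, \<dots>, n - 1\<close>; every finite abelian group is isomorphic to one with this carrier, and its
  neutral element may carry any number. The group is given by its order and its Cayley table,
  row by row, and the local rule by the table of its values.
\<close>

type_synonym ca_input = "nat monoid \<times> nat \<times> (nat list \<Rightarrow> nat)"

definition additive_ca_inputs :: "ca_input set" where
  "additive_ca_inputs = {(G, r, \<delta>). carrier G = {..<order G} \<and> additive_ca G r \<delta>}"

definition group_table :: "nat monoid \<Rightarrow> nat list" where
  "group_table G = [x \<otimes>\<^bsub>G\<^esub> y. x \<leftarrow> [0..<order G], y \<leftarrow> [0..<order G]]"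

text \<open>
  \<open>List.n_lists k\<close> enumerates \<open>k\<close>-tuples with the first component varying fastest, so the value at
  \<open>xs\<close> is at position \<open>\<Sum>i\<le>2*r. xs ! i * n ^ i\<close>.
\<close>

definition rule_table :: "nat \<Rightarrow> nat \<Rightarrow> (nat list \<Rightarrow> nat) \<Rightarrow> nat list" where
  "rule_table n r \<delta> = map \<delta> (List.n_lists (2 * r + 1) [0..<n])"

definition encode_ca :: "ca_input \<Rightarrow> nat list" where
  "encode_ca = (\<lambda>(G, r, \<delta>).
     [order G, list_encode (group_table G), r, list_encode (rule_table (order G) r \<delta>)])"

end

theory Submission
  imports Defs
begin

text \<open>
  Let \<open>n\<close> be the order of \<open>G\<close>. Because \<open>F\<close> is additive and commutes with shifts, it is
  equicontinuous if all powers \<open>F\<^sup>k\<close> have a common radius \<open>R\<close>, and sensitive otherwise.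

  Suppose such an \<open>R\<close> exists. On constant configurations \<open>F\<^sup>k = F\<^sup>m\<close> for some \<open>k < m \<le> n\<^sup>n\<close>, so
  \<open>Q = F\<^sup>m - F\<^sup>k\<close> kills the kernel of the difference operator \<open>\<Delta>\<close>, hence \<open>Q\<^sup>j\<close> kills the
  kernel of \<open>\<Delta>\<^sup>j\<close>. Elements of that kernel take arbitrary values on windows of length \<open>j\<close>, and every
  \<open>Q\<^sup>j\<close> has radius \<open>R\<close>; taking \<open>j = 2 R + 1\<close>, \<open>Q\<close> is nilpotent. On configurations
  with bounded support to the left, the chain of kernels of the \<open>Q\<^sup>j\<close> is controlled by the chain of
  their sets of leading values in \<open>G\<close>, so already \<open>Q\<^sup>n = 0\<close>. Therefore every orbit, observed at one
  cell, satisfies a recurrence of order \<open>m n\<close> with values in \<open>G\<close>, and pigeonhole gives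
  \<open>F\<^sup>N\<^sup>+\<^sup>N\<^sup>! = F\<^sup>N\<close> with \<open>N\<close> depending only on \<open>n\<close>.

  Conversely this identity bounds the radii of all powers, and it can be checked on finitely many words.
\<close>

section \<open>Nilpotency and periodicity\<close>

lemma configs_iff: "c \<in> configs S \<longleftrightarrow> (\<forall>i. c i \<in> S)"
  by (auto simp: configs_def PiE_def Pi_def extensional_def)

definition local_radius :: "'a set \<Rightarrow> ((int \<Rightarrow> 'a) \<Rightarrow> int \<Rightarrow> 'a) \<Rightarrow> nat \<Rightarrow> bool" where
  "local_radius S H R \<longleftrightarrow> (\<forall>c\<in>configs S. \<forall>d\<in>configs S. \<forall>i.
     (\<forall>j. \<bar>j - i\<bar> \<le> int R \<longrightarrow> c j = d j) \<longrightarrow> H c i = H d i)"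

lemma local_radiusD:
  assumes "local_radius S H R" "c \<in> configs S" "d \<in> configs S"
    and "\<And>j. \<bar>j - i\<bar> \<le> int R \<Longrightarrow> c j = d j"
  shows "H c i = H d i"
  using assms unfolding local_radius_def by blast

lemma local_radius_mono: "local_radius S H R \<Longrightarrow> R \<le> R' \<Longrightarrow> local_radius S H R'"
  unfolding local_radius_def by (meson of_nat_le_iff order_trans)

lemma local_radius_funpow:
  assumes "local_radius S H R" "H \<in> configs S \<rightarrow> configs S"
  shows "local_radius S (H ^^ k) (k * R)"
proof (induction k)
  case 0
  then show ?case by (simp add: local_radius_def)
next
  case (Suc k)
  have cl: "(H ^^ k) c \<in> configs S" if "c \<in> configs S" for c
    using that assms(2) by (induction k) (auto simp: Pi_def)
  show ?case
    unfolding local_radius_def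
  proof (intro ballI allI impI)
    fix c d i
    assume c: "c \<in> configs S" and d: "d \<in> configs S"
      and eq: "\<forall>j. \<bar>j - i\<bar> \<le> int (Suc k * R) \<longrightarrow> c j = d j"
    show "(H ^^ Suc k) c i = (H ^^ Suc k) d i"
      unfolding funpow.simps comp_def
    proof (rule local_radiusD[OF assms(1) cl[OF c] cl[OF d]])
      fix j assume j: "\<bar>j - i\<bar> \<le> int R"
      show "(H ^^ k) c j = (H ^^ k) d j"
      proof (rule local_radiusD[OF Suc.IH c d])
        fix l assume l: "\<bar>l - j\<bar> \<le> int (k * R)"
        have "\<bar>l - i\<bar> \<le> int (k * R) + int R" using l j by linarith
        then show "c l = d l" using eq by (simp add: algebra_simps)
      qed
    qed
  qed
qed

locale config_endo = comm_group G for G (structure) +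
  fixes H :: "(int \<Rightarrow> 'a) \<Rightarrow> int \<Rightarrow> 'a"
  assumes H_closed: "c \<in> configs (carrier G) \<Longrightarrow> H c \<in> configs (carrier G)"
    and H_diff: "c \<in> configs (carrier G) \<Longrightarrow> d \<in> configs (carrier G) \<Longrightarrow>
      H (\<lambda>i. c i \<otimes> inv d i) = (\<lambda>i. H c i \<otimes> inv H d i)"
    and H_shift: "c \<in> configs (carrier G) \<Longrightarrow> H (\<lambda>i. c (i + s)) = (\<lambda>i. H c (i + s))"
begin

abbreviation C where "C \<equiv> configs (carrier G)"

abbreviation one_config :: "int \<Rightarrow> 'a" where "one_config \<equiv> \<lambda>_. \<one>"

definition delta :: "(int \<Rightarrow> 'a) \<Rightarrow> int \<Rightarrow> 'a" where
  "delta c = (\<lambda>i. c (i + 1) \<otimes> inv c i)"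

lemma one_config_closed: "one_config \<in> C"
  by (simp add: configs_iff)

lemma shift_closed: "c \<in> C \<Longrightarrow> (\<lambda>i. c (i + s)) \<in> C"
  by (simp add: configs_iff)

lemma diff_closed: "c \<in> C \<Longrightarrow> d \<in> C \<Longrightarrow> (\<lambda>i. c i \<otimes> inv d i) \<in> C"
  by (simp add: configs_iff)

lemma delta_closed: "c \<in> C \<Longrightarrow> delta c \<in> C"
  by (simp add: configs_iff delta_def)

lemma H_one: "H one_config = one_config"
proof -
  have "H (\<lambda>i. one_config i \<otimes> inv one_config i) = (\<lambda>i. H one_config i \<otimes> inv H one_config i)"
    by (rule H_diff[OF one_config_closed one_config_closed])
  moreover have "H one_config \<in> C"
    by (rule H_closed[OF one_config_closed])
  ultimately show ?thesis by (simp add: configs_iff)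
qed

lemma eq_if_diff_one: "a \<in> carrier G \<Longrightarrow> b \<in> carrier G \<Longrightarrow> a \<otimes> inv b = \<one> \<Longrightarrow> a = b"
  by (metis inv_closed inv_equality inv_inv)

lemma funpow_endo: "config_endo G (H ^^ k)"
proof (induction k)
  case 0
  show ?case by unfold_locales auto
next
  case (Suc k)
  interpret K: config_endo G "H ^^ k" by (rule Suc.IH)
  show ?case
    by unfold_locales (simp_all add: H_closed K.H_closed H_diff K.H_diff H_shift K.H_shift)
qed

lemma funpow_closed: "c \<in> C \<Longrightarrow> (H ^^ k) c \<in> C"
  by (rule config_endo.H_closed[OF funpow_endo])

lemma H_delta: "c \<in> C \<Longrightarrow> H (delta c) = delta (H c)"
  unfolding delta_def by (simp add: H_diff shift_closed H_shift)

lemma constant_if_delta_one: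
  assumes "c \<in> C" "delta c = one_config"
  shows "c = (\<lambda>_. c 0)"
proof
  fix i
  have step: "c (i + 1) = c i" for i
    using assms eq_if_diff_one[of "c (i + 1)" "c i"] by (auto simp: delta_def configs_iff fun_eq_iff)
  show "c i = c 0"
    by (induction i rule: int_induct[where k = 0]) (use step step[of "_ - 1"] in auto)
qed

lemma funpow_kills_delta_kernel:
  assumes const: "\<And>g. g \<in> carrier G \<Longrightarrow> H (\<lambda>_. g) = one_config"
    and "c \<in> C" "(delta ^^ j) c = one_config"
  shows "(H ^^ j) c = one_config"
  using assms(2,3)
proof (induction j arbitrary: c)
  case 0
  then show ?case by simp
next
  case (Suc j)
  interpret K: config_endo G "H ^^ j" by (rule funpow_endo)
  have "(delta ^^ j) (delta c) = one_config"
    using Suc.prems(2) by (simp only: funpow_Suc_right comp_def)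
  then have "(H ^^ j) (delta c) = one_config"
    by (rule Suc.IH[OF delta_closed[OF Suc.prems(1)]])
  then have "delta ((H ^^ j) c) = one_config"
    using K.H_delta[OF Suc.prems(1)] by simp
  then have eq: "(H ^^ j) c = (\<lambda>_. (H ^^ j) c 0)"
    by (rule constant_if_delta_one[OF K.H_closed[OF Suc.prems(1)]])
  have "H (\<lambda>_. (H ^^ j) c 0) = one_config"
    using K.H_closed[OF Suc.prems(1)] by (intro const) (simp add: configs_iff)
  then have "H ((H ^^ j) c) = one_config"
    by (simp only: eq[symmetric])
  then show ?case by simp
qed

lemma delta_antiderivative:
  assumes "d \<in> C" "g \<in> carrier G"
  obtains c where "c \<in> C" "c a = g" "delta c = d"
proof -
  define p where "p = rec_nat g (\<lambda>k y. d (a + int k) \<otimes> y)"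
  define q where "q = rec_nat g (\<lambda>k y. inv d (a - 1 - int k) \<otimes> y)"
  have d: "d i \<in> carrier G" for i using assms(1) by (simp add: configs_iff)
  have p: "p k \<in> carrier G" for k by (induction k) (simp_all add: p_def assms d)
  have q: "q k \<in> carrier G" for k by (induction k) (simp_all add: q_def assms d)
  define c where "c i = (if a \<le> i then p (nat (i - a)) else q (nat (a - i)))" for i
  have "c \<in> C" by (simp add: configs_iff c_def p q)
  moreover have "c a = g" by (simp add: c_def p_def)
  moreover have "delta c = d"
  proof
    fix i
    have ci: "c i \<in> carrier G" using \<open>c \<in> C\<close> by (simp add: configs_iff)
    have "c (i + 1) = d i \<otimes> c i"
    proof (cases "a \<le> i")
      case True
      then have "nat (i + 1 - a) = Suc (nat (i - a))" by simp
      then show ?thesis using True by (simp add: c_def p_def)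
    next
      case False
      define k where "k = nat (a - i - 1)"
      have i: "i = a - 1 - int k" using False by (simp add: k_def)
      have "c i = inv d i \<otimes> q k"
        using False i by (simp add: c_def q_def nat_add_distrib)
      moreover have "c (i + 1) = q k"
      proof (cases "k = 0")
        case True
        then show ?thesis using i by (simp add: c_def q_def p_def)
      next
        case False
        then have "\<not> a \<le> i + 1" "nat (a - (i + 1)) = k" using i by auto
        then show ?thesis by (simp add: c_def)
      qed
      ultimately show ?thesis using d q by (simp add: m_assoc[symmetric])
    qed
    then show "delta c i = d i"
      using d ci by (simp add: delta_def m_assoc)
  qed
  ultimately show ?thesis by (rule that)
qed

lemma delta_kernel_interpolation:
  assumes "v \<in> C"
  shows "\<exists>c\<in>C. (delta ^^ j) c = one_config \<and> (\<forall>i. a \<le> i \<and> i < a + int j \<longrightarrow> c i = v i)"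
  using assms
proof (induction j arbitrary: v)
  case 0
  then show ?case using one_config_closed by auto
next
  case (Suc j)
  obtain d where d: "d \<in> C" "(delta ^^ j) d = one_config"
    and dv: "\<And>i. a \<le> i \<Longrightarrow> i < a + int j \<Longrightarrow> d i = delta v i"
    using Suc.IH[OF delta_closed[OF Suc.prems]] by blast
  obtain c where c: "c \<in> C" "c a = v a" "delta c = d"
    using delta_antiderivative[OF d(1), of "v a" a] Suc.prems by (auto simp: configs_iff)
  have mem: "c i \<in> carrier G" "v i \<in> carrier G" for i
    using c(1) Suc.prems by (simp_all add: configs_iff)
  have "c i = v i" if "a \<le> i" "i < a + int (Suc j)" for i
    using that
  proof (induction i rule: int_ge_induct)
    case base
    then show ?case by (simp add: c(2))
  next
    case (step i)
    have "delta c i = delta v i" using step dv c(3) by simp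
    then show ?case using step mem by (simp add: delta_def)
  qed
  moreover have "(delta ^^ Suc j) c = one_config"
    using d(2) c(3) by (simp only: funpow_Suc_right comp_def)
  ultimately show ?case using c(1) by blast
qed

lemma nilpotent_if_bounded_radius:
  assumes const: "\<And>g. g \<in> carrier G \<Longrightarrow> H (\<lambda>_. g) = one_config"
    and R: "\<And>j. local_radius (carrier G) (H ^^ j) R"
    and c: "c \<in> C"
  shows "(H ^^ (2 * R + 1)) c = one_config"
proof
  fix i
  obtain c' where c': "c' \<in> C" "(delta ^^ (2 * R + 1)) c' = one_config"
    and eq: "\<And>l. i - int R \<le> l \<Longrightarrow> l < i - int R + int (2 * R + 1) \<Longrightarrow> c' l = c l"
    using delta_kernel_interpolation[OF c] by blast
  have "(H ^^ (2 * R + 1)) c i = (H ^^ (2 * R + 1)) c' i"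
    by (rule local_radiusD[OF R c c'(1)]) (use eq in auto)
  also have "(H ^^ (2 * R + 1)) c' = one_config"
    by (rule funpow_kills_delta_kernel[OF const c'])
  finally show "(H ^^ (2 * R + 1)) c i = \<one>" .
qed

definition leading_values :: "nat \<Rightarrow> 'a set" where
  "leading_values j = {c 0 |c. c \<in> C \<and> (\<forall>i<0. c i = \<one>) \<and> (H ^^ j) c = one_config}"

lemma leading_values_mono: "leading_values j \<subseteq> leading_values (Suc j)"
  unfolding leading_values_def using H_one by fastforce

lemma leading_values_subset: "leading_values j \<subseteq> carrier G"
  unfolding leading_values_def by (auto simp: configs_iff)

lemma one_in_leading_values: "\<one> \<in> leading_values j"
proof -
  have "(H ^^ j) one_config = one_config"
    by (rule config_endo.H_one[OF funpow_endo])
  then show ?thesis unfolding leading_values_def using one_config_closed by force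
qed

lemma kernel_eq_if_leading_values_eq:
  assumes eq: "leading_values j = leading_values (Suc j)"
    and R: "local_radius (carrier G) H R"
    and c: "c \<in> C" and left: "\<And>i. i < a \<Longrightarrow> c i = \<one>"
    and ker: "(H ^^ Suc j) c = one_config"
  shows "(H ^^ j) c = one_config"
proof
  fix i
  interpret J: config_endo G "H ^^ j" by (rule funpow_endo)
  interpret S: config_endo G "H ^^ Suc j" by (rule funpow_endo)
  have J_local: "local_radius (carrier G) (H ^^ j) (j * R)"
    using R H_closed by (intro local_radius_funpow) auto
  have *: "\<exists>d\<in>C. (\<forall>i<a + int m. d i = \<one>) \<and> (H ^^ j) d = (H ^^ j) c \<and> (H ^^ Suc j) d = one_config" for m
  proof (induction m)
    case 0
    show ?case using c left ker by auto
  next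
    case (Suc m)
    then obtain d where d: "d \<in> C" "\<And>i. i < a + int m \<Longrightarrow> d i = \<one>"
      "(H ^^ j) d = (H ^^ j) c" "(H ^^ Suc j) d = one_config" by blast
    have "(H ^^ Suc j) (\<lambda>i. d (i + (a + int m))) = one_config"
      using S.H_shift[OF d(1)] d(4) by simp
    then have "d (a + int m) \<in> leading_values (Suc j)"
      unfolding leading_values_def using d(1,2) shift_closed[OF d(1)]
      by (intro CollectI exI[of _ "\<lambda>i. d (i + (a + int m))"]) auto
    then obtain e where e: "e \<in> C" "\<And>i. i < 0 \<Longrightarrow> e i = \<one>" "(H ^^ j) e = one_config"
      "e 0 = d (a + int m)"
      unfolding eq[symmetric] by (auto simp: leading_values_def)
    define f where "f = (\<lambda>i. e (i + - (a + int m)))"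
    have f: "f \<in> C" unfolding f_def by (rule shift_closed[OF e(1)])
    have Jf: "(H ^^ j) f = one_config"
      unfolding f_def using J.H_shift[OF e(1)] e(3) by simp
    have Sf: "(H ^^ Suc j) f = one_config"
      using Jf H_one by simp
    let ?d = "\<lambda>i. d i \<otimes> inv f i"
    have mem: "d i \<in> carrier G" "f i \<in> carrier G" for i
      using d(1) f by (simp_all add: configs_iff)
    have "?d i = \<one>" if "i < a + int (Suc m)" for i
    proof (cases "i = a + int m")
      case True
      then have "f i = d i" by (simp add: f_def e(4))
      then show ?thesis using mem by simp
    next
      case False
      then show ?thesis using that d(2) e(2) by (simp add: f_def)
    qed
    moreover have "(H ^^ j) ?d = (H ^^ j) c"
      using J.H_diff[OF d(1) f] Jf d(3) J.H_closed[OF c] by (simp add: configs_iff)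
    moreover have "(H ^^ Suc j) ?d = one_config"
      using S.H_diff[OF d(1) f] Sf d(4) by simp
    ultimately show ?case
      by (intro bexI[of _ ?d] conjI allI impI diff_closed[OF d(1) f])
  qed
  obtain d where d: "d \<in> C" "\<forall>l<a + int (nat (i + int (j * R) + 1 - a)). d l = \<one>"
      "(H ^^ j) d = (H ^^ j) c"
    using *[of "nat (i + int (j * R) + 1 - a)"] by (elim bexE conjE) (rule that)
  have "(H ^^ j) d i = (H ^^ j) one_config i"
  proof (rule local_radiusD[OF J_local d(1) one_config_closed])
    fix l assume "\<bar>l - i\<bar> \<le> int (j * R)"
    then show "d l = \<one>" by (intro d(2)[rule_format]) linarith
  qed
  then show "(H ^^ j) c i = \<one>" using d(3) J.H_one by simp
qed

lemma leading_values_stabilise: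
  assumes "finite (carrier G)"
  obtains j where "j < order G" "leading_values j = leading_values (Suc j)"
proof (rule ccontr)
  assume "\<not> thesis"
  with that have strict: "leading_values j \<subset> leading_values (Suc j)" if "j < order G" for j
    using leading_values_mono that by blast
  have fin: "finite (leading_values j)" for j
    using leading_values_subset assms by (rule finite_subset)
  have "j < card (leading_values j)" if "j \<le> order G" for j
    using that
  proof (induction j)
    case 0
    show ?case using one_in_leading_values fin by (auto simp: card_gt_0_iff)
  next
    case (Suc j)
    then show ?case using psubset_card_mono[OF fin strict[of j]] by linarith
  qed
  from this[of "order G"] show False
    using card_mono[OF assms leading_values_subset[of "order G"]] by (simp add: order_def)
qed

lemma nilpotency_index_le_order:
  assumes fin: "finite (carrier G)" and R: "local_radius (carrier G) H R"
    and nil: "\<And>c. c \<in> C \<Longrightarrow> (H ^^ s) c = one_config"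
    and c: "c \<in> C"
  shows "(H ^^ order G) c = one_config"
proof
  fix i
  obtain j where j: "j < order G" "leading_values j = leading_values (Suc j)"
    by (rule leading_values_stabilise[OF fin])
  have one: "(H ^^ k) one_config = one_config" for k
    by (rule config_endo.H_one[OF funpow_endo])
  have ker: "(H ^^ j) c = one_config"
    if "c \<in> C" "\<And>i. i < a \<Longrightarrow> c i = \<one>" "(H ^^ (t + j)) c = one_config" for c t a
    using that
  proof (induction t arbitrary: c a)
    case 0
    then show ?case by simp
  next
    case (Suc t)
    have "H c i = H one_config i" if "i < a - int R" for i
      by (rule local_radiusD[OF R Suc.prems(1) one_config_closed])
        (use that Suc.prems(2) in auto)
    then have "H c i = \<one>" if "i < a - int R" for i using that H_one by simp
    moreover have "(H ^^ (t + j)) (H c) = one_config"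
      using Suc.prems(3) by (simp add: funpow_swap1)
    ultimately have "(H ^^ j) (H c) = one_config"
      using Suc.IH[OF H_closed[OF Suc.prems(1)]] by blast
    then have "(H ^^ Suc j) c = one_config" by (simp add: funpow_swap1)
    with kernel_eq_if_leading_values_eq[OF j(2) R Suc.prems(1,2)] show ?case by blast
  qed
  have loc: "local_radius (carrier G) (H ^^ order G) (order G * R)"
    using R H_closed by (intro local_radius_funpow) auto
  define d where "d l = (if l < i - int (order G * R) then \<one> else c l)" for l
  have d: "d \<in> C" using c by (simp add: d_def configs_iff)
  have "(H ^^ (s + j)) d = one_config"
    using nil[OF funpow_closed[OF d]] by (simp add: funpow_add)
  then have "(H ^^ j) d = one_config"
    using d by (intro ker[of d "i - int (order G * R)" s]) (auto simp: d_def)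
  then have "(H ^^ (order G - j + j)) d = one_config"
    unfolding funpow_add by (simp add: one)
  then have "(H ^^ order G) d = one_config" using j(1) by simp
  moreover have "(H ^^ order G) c i = (H ^^ order G) d i"
    by (rule local_radiusD[OF loc c d]) (auto simp: d_def)
  ultimately show "(H ^^ order G) c i = \<one>" by simp
qed

definition seq_diff :: "nat \<Rightarrow> nat \<Rightarrow> (nat \<Rightarrow> 'a) \<Rightarrow> nat \<Rightarrow> 'a" where
  "seq_diff m k x = (\<lambda>t. x (t + m) \<otimes> inv x (t + k))"

lemma seq_diff_funpow_inj:
  assumes "k < m"
    and "\<And>t. x t \<in> carrier G" "\<And>t. y t \<in> carrier G"
    and "(seq_diff m k ^^ n) x = (seq_diff m k ^^ n) y"
    and "\<And>t. t < m * n \<Longrightarrow> x t = y t"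
  shows "x = y"
  using assms(2-)
proof (induction n arbitrary: x y)
  case 0
  then show ?case by simp
next
  case (Suc n)
  have "seq_diff m k x = seq_diff m k y"
  proof (rule Suc.IH)
    show "(seq_diff m k ^^ n) (seq_diff m k x) = (seq_diff m k ^^ n) (seq_diff m k y)"
      using Suc.prems(3) by (simp add: funpow_swap1)
    show "seq_diff m k x t = seq_diff m k y t" if "t < m * n" for t
      using that assms(1) by (simp add: seq_diff_def Suc.prems(4))
  qed (simp_all add: seq_diff_def Suc.prems(1,2))
  then have diff: "x (t + m) \<otimes> inv x (t + k) = y (t + m) \<otimes> inv y (t + k)" for t
    unfolding seq_diff_def by meson
  show ?case
  proof
    fix t
    show "x t = y t"
    proof (induction t rule: less_induct)
      case (less t)
      show ?case
      proof (cases "t < m")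
        case True
        then show ?thesis by (intro Suc.prems(4)) simp
      next
        case False
        then have "x (t - m + k) = y (t - m + k)" using assms(1) by (intro less.IH) auto
        with diff[of "t - m"] False show ?thesis using Suc.prems(1,2) by simp
      qed
    qed
  qed
qed

lemma funpow_constant:
  assumes "g \<in> carrier G"
  shows "(H ^^ k) (\<lambda>_. g) = (\<lambda>_. (H ^^ k) (\<lambda>_. g) 0)"
proof
  fix i
  have "(\<lambda>_. g) \<in> C" using assms by (simp add: configs_iff)
  from config_endo.H_shift[OF funpow_endo this, of k i]
  show "(H ^^ k) (\<lambda>_. g) i = (H ^^ k) (\<lambda>_. g) 0" by (metis add_0)
qed

lemma funpow_eq_on_constants:
  assumes "finite (carrier G)"
  obtains k m where "k < m" "m \<le> order G ^ order G"
    "\<And>g. g \<in> carrier G \<Longrightarrow> (H ^^ k) (\<lambda>_. g) = (H ^^ m) (\<lambda>_. g)"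
proof -
  let ?f = "\<lambda>k. \<lambda>g\<in>carrier G. (H ^^ k) (\<lambda>_. g) 0"
  let ?N = "order G ^ order G"
  have cl: "(H ^^ k) (\<lambda>_. g) 0 \<in> carrier G" if "g \<in> carrier G" for g k
    using funpow_closed[of "\<lambda>_. g" k] that by (simp add: configs_iff)
  have "?f ` {..?N} \<subseteq> carrier G \<rightarrow>\<^sub>E carrier G" using cl by auto
  then have "card (?f ` {..?N}) \<le> card (carrier G \<rightarrow>\<^sub>E carrier G)"
    using assms by (intro card_mono finite_PiE) auto
  also have "\<dots> = ?N" using assms by (simp add: card_PiE order_def)
  finally have "\<not> inj_on ?f {..?N}"
    by (intro pigeonhole) simp
  then obtain k m where km: "k < m" "m \<le> ?N" "?f k = ?f m"
    by (auto simp: inj_on_def) (metis linorder_neqE_nat)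
  have "(H ^^ k) (\<lambda>_. g) = (H ^^ m) (\<lambda>_. g)" if "g \<in> carrier G" for g
    using funpow_constant[OF that, of k] funpow_constant[OF that, of m] fun_cong[OF km(3), of g] that
    by simp
  with km show ?thesis by (intro that)
qed

lemma funpow_periodic_if_bounded_radius:
  assumes fin: "finite (carrier G)"
    and R: "\<And>k. local_radius (carrier G) (H ^^ k) R"
    and N: "N = order G ^ (order G ^ order G * order G)"
    and c: "c \<in> C"
  shows "(H ^^ (N + fact N)) c = (H ^^ N) c"
proof
  fix i
  obtain k m where km: "k < m" "m \<le> order G ^ order G"
    and const: "\<And>g. g \<in> carrier G \<Longrightarrow> (H ^^ k) (\<lambda>_. g) = (H ^^ m) (\<lambda>_. g)"
    using funpow_eq_on_constants[OF fin] by metis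
  define Q where "Q c = (\<lambda>i. (H ^^ m) c i \<otimes> inv (H ^^ k) c i)" for c
  interpret K: config_endo G "H ^^ k" by (rule funpow_endo)
  interpret M: config_endo G "H ^^ m" by (rule funpow_endo)
  have Q_endo: "config_endo G Q"
  proof unfold_locales
    fix c d assume c: "c \<in> C" and d: "d \<in> C"
    have mem: "(H ^^ k) c i \<in> carrier G" "(H ^^ k) d i \<in> carrier G" "(H ^^ m) c i \<in> carrier G" "(H ^^ m) d i \<in> carrier G" for i
      using K.H_closed[OF c] K.H_closed[OF d] M.H_closed[OF c] M.H_closed[OF d]
      by (simp_all add: configs_iff)
    show "Q (\<lambda>i. c i \<otimes> inv d i) = (\<lambda>i. Q c i \<otimes> inv Q d i)"
      unfolding Q_def K.H_diff[OF c d] M.H_diff[OF c d]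
      by (intro ext) (simp add: mem inv_mult_group m_ac)
  qed (simp_all add: Q_def K.H_shift M.H_shift K.H_closed M.H_closed diff_closed)
  interpret Q: config_endo G Q by (rule Q_endo)
  have Q_const: "Q (\<lambda>_. g) = one_config" if "g \<in> carrier G" for g
    using const[OF that] M.H_closed[of "\<lambda>_. g"] that by (simp add: Q_def configs_iff)
  have trace: "(seq_diff m k ^^ j) (\<lambda>t. (H ^^ t) c i) = (\<lambda>t. (H ^^ t) ((Q ^^ j) c) i)"
    if "c \<in> C" for c i j
    using that
  proof (induction j arbitrary: c)
    case 0
    then show ?case by simp
  next
    case (Suc j)
    have "seq_diff m k (\<lambda>t. (H ^^ t) c i) = (\<lambda>t. (H ^^ t) (Q c) i)"
    proof
      fix t
      interpret T: config_endo G "H ^^ t" by (rule funpow_endo)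
      show "seq_diff m k (\<lambda>t. (H ^^ t) c i) t = (H ^^ t) (Q c) i"
        unfolding seq_diff_def Q_def T.H_diff[OF M.H_closed[OF Suc.prems] K.H_closed[OF Suc.prems]]
        by (simp add: funpow_add)
    qed
    then show ?case
      using Suc.IH[OF Q.H_closed[OF Suc.prems]] by (simp add: funpow_swap1)
  qed
  have Q_radius: "local_radius (carrier G) (Q ^^ j) R" for j
    unfolding local_radius_def
  proof (intro ballI allI impI)
    fix c d i
    assume c: "c \<in> C" and d: "d \<in> C" and eq: "\<forall>l. \<bar>l - i\<bar> \<le> int R \<longrightarrow> c l = d l"
    have "(\<lambda>t. (H ^^ t) c i) = (\<lambda>t. (H ^^ t) d i)"
      by (intro ext local_radiusD[OF R c d]) (use eq in auto)
    then have "(\<lambda>t. (H ^^ t) ((Q ^^ j) c) i) = (\<lambda>t. (H ^^ t) ((Q ^^ j) d) i)"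
      using trace[OF c, of j i] trace[OF d, of j i] by simp
    from fun_cong[OF this, of 0] show "(Q ^^ j) c i = (Q ^^ j) d i" by simp
  qed
  have Q_nil: "(Q ^^ order G) c = one_config" if "c \<in> C" for c
    by (rule Q.nilpotency_index_le_order[OF fin _ Q.nilpotent_if_bounded_radius[OF Q_const Q_radius] that])
      (use Q_radius[of 1] in simp_all)
  define x where "x a = (\<lambda>t. (H ^^ t) ((H ^^ a) c) i)" for a
  have x_closed: "x a t \<in> carrier G" for a t
    using funpow_closed[OF funpow_closed[OF c]] by (simp add: x_def configs_iff)
  have x_diff: "(seq_diff m k ^^ order G) (x a) = (\<lambda>_. \<one>)" for a
  proof -
    have "(H ^^ t) one_config = one_config" for t
      by (rule config_endo.H_one[OF funpow_endo])
    then show ?thesis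
      unfolding x_def trace[OF funpow_closed[OF c]] Q_nil[OF funpow_closed[OF c]] by simp
  qed
  let ?f = "\<lambda>a. \<lambda>t\<in>{..<m * order G}. x a t"
  have "?f ` {..N} \<subseteq> {..<m * order G} \<rightarrow>\<^sub>E carrier G"
    using x_closed by (intro image_subsetI) (simp add: restrict_PiE_iff)
  then have "card (?f ` {..N}) \<le> card ({..<m * order G} \<rightarrow>\<^sub>E carrier G)"
    using fin by (intro card_mono finite_PiE) auto
  also have "\<dots> = order G ^ (m * order G)" by (simp add: card_PiE order_def)
  also have "\<dots> \<le> N"
    unfolding N using km(2) order_gt_0_iff_finite fin by (intro power_increasing mult_right_mono) (auto simp: Suc_le_eq)
  finally have "\<not> inj_on ?f {..N}" by (intro pigeonhole) simp
  then obtain a b where ab: "a < b" "b \<le> N" "?f a = ?f b"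
    by (auto simp: inj_on_def) (metis linorder_neqE_nat)
  have "x a t = x b t" if "t < m * order G" for t
    using fun_cong[OF ab(3), of t] that by simp
  then have x_eq: "x a = x b"
    by (intro seq_diff_funpow_inj[OF km(1) x_closed x_closed, of "order G"]) (simp add: x_diff)
  have period: "(H ^^ (t + (b - a))) c i = (H ^^ t) c i" if "a \<le> t" for t
    using fun_cong[OF x_eq, of "t - a"] that ab(1)
    by (simp add: x_def fun_cong[OF funpow_add[unfolded comp_def, symmetric]])
  have "(H ^^ (N + q * (b - a))) c i = (H ^^ N) c i" for q
  proof (induction q)
    case (Suc q)
    then show ?case using period[of "N + q * (b - a)"] ab by (simp add: ac_simps)
  qed simp
  moreover have "b - a dvd fact N" using ab by (intro dvd_fact) auto
  then obtain q where "fact N = (b - a) * q" by (rule dvdE)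
  ultimately show "(H ^^ (N + fact N)) c i = (H ^^ N) c i" by (metis mult.commute)
qed

lemma bounded_radius_if_periodic:
  assumes R: "local_radius (carrier G) H R"
    and "0 < p"
    and per: "\<And>c. c \<in> C \<Longrightarrow> (H ^^ (N + p)) c = (H ^^ N) c"
  shows "local_radius (carrier G) (H ^^ k) ((N + p) * R)"
proof -
  have "\<exists>k'<N + p. \<forall>c\<in>C. (H ^^ k) c = (H ^^ k') c"
  proof (induction k rule: less_induct)
    case (less k)
    show ?case
    proof (cases "k < N + p")
      case False
      have "(H ^^ k) c = (H ^^ (k - p)) c" if "c \<in> C" for c
      proof -
        have "(H ^^ (k - (N + p) + (N + p))) c = (H ^^ (k - (N + p) + N)) c"
          using per[OF that] by (simp only: funpow_add comp_def)
        then show ?thesis using False by simp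
      qed
      with less.IH[of "k - p"] False assms(2) show ?thesis by auto
    qed auto
  qed
  then obtain k' where k': "k' < N + p" "\<And>c. c \<in> C \<Longrightarrow> (H ^^ k) c = (H ^^ k') c" by blast
  have "local_radius (carrier G) (H ^^ k') (k' * R)"
    using R H_closed by (intro local_radius_funpow) auto
  then have loc: "local_radius (carrier G) (H ^^ k') ((N + p) * R)"
    using k'(1) by (elim local_radius_mono) simp
  show ?thesis
    unfolding local_radius_def
  proof (intro ballI allI impI)
    fix c d i
    assume c: "c \<in> C" and d: "d \<in> C" and eq: "\<forall>j. \<bar>j - i\<bar> \<le> int ((N + p) * R) \<longrightarrow> c j = d j"
    have "(H ^^ k') c i = (H ^^ k') d i"
      by (rule local_radiusD[OF loc c d]) (use eq in blast)
    then show "(H ^^ k) c i = (H ^^ k) d i"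
      using k'(2)[OF c] k'(2)[OF d] by simp
  qed
qed

end

section \<open>Closure properties of total recursive functions\<close>

definition total_recursive :: "nat \<Rightarrow> (nat list \<Rightarrow> nat) \<Rightarrow> bool" where
  "total_recursive k f \<longleftrightarrow> (\<exists>e. \<forall>xs. length xs = k \<longrightarrow> rec_eval e xs (f xs))"

lemma total_recursive_cong:
  assumes "total_recursive k f" "\<And>xs. length xs = k \<Longrightarrow> f xs = g xs"
  shows "total_recursive k g"
  using assms unfolding total_recursive_def by metis

lemma total_recursive_compose:
  assumes "total_recursive (length fs) h" "\<And>f. f \<in> set fs \<Longrightarrow> total_recursive k f"
  shows "total_recursive k (\<lambda>xs. h (map (\<lambda>f. f xs) fs))"
proof -
  obtain e where e: "\<And>ys. length ys = length fs \<Longrightarrow> rec_eval e ys (h ys)"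
    using assms(1) unfolding total_recursive_def by blast
  have "\<forall>f\<in>set fs. \<exists>e. \<forall>xs. length xs = k \<longrightarrow> rec_eval e xs (f xs)"
    using assms(2) unfolding total_recursive_def by blast
  then obtain E where E: "\<And>f xs. f \<in> set fs \<Longrightarrow> length xs = k \<Longrightarrow> rec_eval (E f) xs (f xs)"
    by metis
  have "rec_eval (Comp e (map E fs)) xs (h (map (\<lambda>f. f xs) fs))" if "length xs = k" for xs
  proof (rule rec_eval.Comp)
    show "list_all2 (\<lambda>g y. rec_eval g xs y) (map E fs) (map (\<lambda>f. f xs) fs)"
      using E that by (simp add: list_all2_conv_all_nth)
  qed (simp add: e)
  then show ?thesis unfolding total_recursive_def by blast
qed

lemma total_recursive_nth: "i < k \<Longrightarrow> total_recursive k (\<lambda>xs. xs ! i)"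
  unfolding total_recursive_def by (blast intro: rec_eval.Proj)

lemma total_recursive_tl:
  assumes "total_recursive k f"
  shows "total_recursive (Suc k) (\<lambda>xs. f (tl xs))"
proof -
  have "total_recursive (Suc k) (\<lambda>xs. f (map (\<lambda>g. g xs) (map (\<lambda>i xs. xs ! Suc i) [0..<k])))"
    by (rule total_recursive_compose) (use assms in \<open>auto intro: total_recursive_nth\<close>)
  moreover have "map (\<lambda>g. g xs) (map (\<lambda>i xs. xs ! Suc i) [0..<k]) = tl xs" if "length xs = Suc k" for xs :: "nat list"
    using that by (intro nth_equalityI) (auto simp: nth_tl)
  ultimately show ?thesis by (elim total_recursive_cong) simp
qed

lemma total_recursive_hd: "0 < k \<Longrightarrow> total_recursive k hd"
  by (rule total_recursive_cong[OF total_recursive_nth[of 0]]) (auto simp: hd_conv_nth)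

lemma total_recursive_hd_tl: "Suc 0 < k \<Longrightarrow> total_recursive k (\<lambda>xs. hd (tl xs))"
  using total_recursive_tl[OF total_recursive_hd, of "k - 1"] by simp

lemma total_recursive_compose1:
  assumes "total_recursive 1 (\<lambda>xs. h (xs ! 0))" "total_recursive k f"
  shows "total_recursive k (\<lambda>xs. h (f xs))"
  using total_recursive_compose[of "[f]" "\<lambda>xs. h (xs ! 0)" k] assms by simp

lemma total_recursive_Suc:
  assumes "total_recursive k f"
  shows "total_recursive k (\<lambda>xs. Suc (f xs))"
proof (rule total_recursive_compose1[OF _ assms])
  have "rec_eval Succ xs (Suc (xs ! 0))" if "length xs = 1" for xs
    using that rec_eval.Succ[of "xs ! 0"] by (cases xs) auto
  then show "total_recursive 1 (\<lambda>xs. Suc (xs ! 0))"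
    unfolding total_recursive_def by blast
qed

lemma total_recursive_const: "total_recursive k (\<lambda>_. c)"
proof (induction c)
  case 0
  then show ?case unfolding total_recursive_def by (blast intro: rec_eval.Zero)
qed (rule total_recursive_Suc)

lemma total_recursive_rec_nat:
  assumes "total_recursive k f" "total_recursive k g"
    and "total_recursive (Suc (Suc k)) (\<lambda>xs. h (hd xs) (hd (tl xs)) (tl (tl xs)))"
  shows "total_recursive k (\<lambda>xs. rec_nat (g xs) (\<lambda>i y. h i y xs) (f xs))"
proof -
  obtain e where e: "\<And>xs. length xs = k \<Longrightarrow> rec_eval e xs (g xs)"
    using assms(2) unfolding total_recursive_def by blast
  obtain e' where e': "\<And>xs. length xs = Suc (Suc k) \<Longrightarrow>
      rec_eval e' xs (h (hd xs) (hd (tl xs)) (tl (tl xs)))"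
    using assms(3) unfolding total_recursive_def by blast
  have eval: "rec_eval (PrimRec e e') (n # xs) (rec_nat (g xs) (\<lambda>i y. h i y xs) n)"
    if "length xs = k" for n xs
  proof (induction n)
    case 0
    show ?case using e[OF that] by (simp add: rec_eval.PrimRec_0)
  next
    case (Suc n)
    show ?case
      using rec_eval.PrimRec_Suc[OF Suc.IH e'] that by force
  qed
  have "total_recursive (Suc k) (\<lambda>xs. rec_nat (g (tl xs)) (\<lambda>i y. h i y (tl xs)) (hd xs))"
    unfolding total_recursive_def
  proof (intro exI allI impI)
    fix xs :: "nat list" assume "length xs = Suc k"
    then show "rec_eval (PrimRec e e') xs (rec_nat (g (tl xs)) (\<lambda>i y. h i y (tl xs)) (hd xs))"
      using eval[of "tl xs" "hd xs"] by (cases xs) auto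
  qed
  then have "total_recursive k (\<lambda>xs. (\<lambda>xs. rec_nat (g (tl xs)) (\<lambda>i y. h i y (tl xs)) (hd xs))
      (map (\<lambda>f. f xs) (f # map (\<lambda>i xs. xs ! i) [0..<k])))"
    using assms(1) by (intro total_recursive_compose) (auto intro: total_recursive_nth)
  moreover have "map (\<lambda>f. f xs) (map (\<lambda>i xs. xs ! i) [0..<k]) = xs" if "length xs = k" for xs :: "nat list"
    using that by (intro nth_equalityI) auto
  ultimately show ?thesis by (elim total_recursive_cong) simp
qed

lemma total_recursive_funpow:
  assumes "total_recursive k f" "total_recursive k g"
    and "total_recursive (Suc k) (\<lambda>xs. h (hd xs) (tl xs))"
  shows "total_recursive k (\<lambda>xs. ((\<lambda>y. h y xs) ^^ f xs) (g xs))"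
proof -
  have eq: "((\<lambda>y. h y xs) ^^ n) z = rec_nat z (\<lambda>_ y. h y xs) n" for n z xs
    by (induction n) auto
  show ?thesis
    unfolding eq
    by (intro total_recursive_rec_nat assms total_recursive_tl[OF assms(3)])
qed

lemmas total_recursive_basic =
  total_recursive_nth total_recursive_hd total_recursive_hd_tl
  total_recursive_Suc total_recursive_const

lemma total_recursive_add:
  assumes "total_recursive k f" "total_recursive k g"
  shows "total_recursive k (\<lambda>xs. f xs + g xs)"
proof -
  have "(Suc ^^ n) m = n + m" for n m :: nat by (induction n) auto
  moreover have "total_recursive k (\<lambda>xs. (Suc ^^ f xs) (g xs))"
    by (intro total_recursive_funpow[of k f g "\<lambda>y _. Suc y"] assms total_recursive_basic) auto
  ultimately show ?thesis by simp
qed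

lemma total_recursive_diff:
  assumes "total_recursive k f" "total_recursive k g"
  shows "total_recursive k (\<lambda>xs. f xs - g xs)"
proof -
  have pred: "rec_nat 0 (\<lambda>i _. i) n = n - 1" for n :: nat by (cases n) auto
  have "total_recursive 1 (\<lambda>xs. rec_nat 0 (\<lambda>i _. i) (xs ! 0))"
    by (intro total_recursive_rec_nat[of 1 _ _ "\<lambda>i _ _. i"] total_recursive_basic) auto
  then have "total_recursive (Suc k) (\<lambda>xs. hd xs - 1)"
    unfolding pred by (rule total_recursive_compose1) (rule total_recursive_hd, simp)
  then have "total_recursive k (\<lambda>xs. ((\<lambda>y. y - 1) ^^ g xs) (f xs))"
    by (rule total_recursive_funpow[OF assms(2,1), of "\<lambda>y _. y - 1"])
  moreover have "((\<lambda>y. y - 1) ^^ n) m = m - n" for n m :: nat by (induction n) auto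
  ultimately show ?thesis by simp
qed

lemma total_recursive_sum:
  assumes "total_recursive k f" "total_recursive (Suc k) (\<lambda>xs. g (hd xs) (tl xs))"
  shows "total_recursive k (\<lambda>xs. \<Sum>i<f xs. g i xs)"
proof -
  have eq: "(\<Sum>i<n. g i xs) = rec_nat 0 (\<lambda>i y. g i xs + y) n" for n xs
    by (induction n) auto
  have "total_recursive (Suc (Suc k)) (\<lambda>xs. (\<lambda>xs. g (hd xs) (tl xs))
      (map (\<lambda>f. f xs) (hd # map (\<lambda>i xs. xs ! Suc (Suc i)) [0..<k])))"
    by (rule total_recursive_compose) (use assms(2) in \<open>auto intro: total_recursive_nth total_recursive_hd\<close>)
  moreover have "map (\<lambda>f. f xs) (map (\<lambda>i xs. xs ! Suc (Suc i)) [0..<k]) = tl (tl xs)"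
    if "length xs = Suc (Suc k)" for xs :: "nat list"
    using that by (intro nth_equalityI) (auto simp: nth_tl)
  ultimately have "total_recursive (Suc (Suc k)) (\<lambda>xs. g (hd xs) (tl (tl xs)))"
    by (elim total_recursive_cong) simp
  then show ?thesis
    unfolding eq
    by (intro total_recursive_rec_nat assms(1) total_recursive_add total_recursive_basic) auto
qed

lemma total_recursive_mult:
  assumes "total_recursive k f" "total_recursive k g"
  shows "total_recursive k (\<lambda>xs. f xs * g xs)"
proof -
  have "total_recursive k (\<lambda>xs. \<Sum>i<f xs. g xs)"
    by (intro total_recursive_sum assms total_recursive_tl)
  then show ?thesis by simp
qed

lemma total_recursive_power:
  assumes "total_recursive k f" "total_recursive k g"
  shows "total_recursive k (\<lambda>xs. f xs ^ g xs)"
proof -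
  have "total_recursive k (\<lambda>xs. ((\<lambda>y. y * f xs) ^^ g xs) 1)"
    by (intro total_recursive_funpow[of k g _ "\<lambda>y xs. y * f xs"] assms total_recursive_mult
        total_recursive_tl[OF assms(1)] total_recursive_basic) auto
  moreover have "((\<lambda>y. y * m) ^^ n) 1 = m ^ n" for n m :: nat by (induction n) auto
  ultimately show ?thesis by simp
qed

lemma total_recursive_fact:
  assumes "total_recursive k f"
  shows "total_recursive k (\<lambda>xs. fact (f xs))"
proof -
  have "total_recursive k (\<lambda>xs. rec_nat 1 (\<lambda>i y. Suc i * y) (f xs))"
    by (intro total_recursive_rec_nat[of k f _ "\<lambda>i y _. Suc i * y"] assms
        total_recursive_mult total_recursive_basic) auto
  moreover have "rec_nat 1 (\<lambda>i y. Suc i * y) n = fact n" for n :: nat by (induction n) auto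
  ultimately show ?thesis by simp
qed

lemma card_less_eq_sum: "card {i. i < m \<and> P i} = (\<Sum>i<m. if P i then 1 else 0)" for m :: nat
  using sum.inter_filter[of "{..<m}" "\<lambda>_. 1 :: nat" P] by simp

lemma div_eq_sum: "m div n = (\<Sum>i<m. (1 - (Suc i * n - m)) * (1 - (1 - n)))" for m n :: nat
proof (cases "n = 0")
  case False
  have "m div n = card {i. i < m \<and> Suc i * n \<le> m}"
  proof -
    have "{i. i < m \<and> Suc i * n \<le> m} = {..<m div n}"
    proof (rule Set.set_eqI)
      fix i
      have "Suc i * n \<le> m \<longleftrightarrow> i < m div n"
        using False by (simp only: less_eq_div_iff_mult_less_eq[symmetric] Suc_le_eq neq0_conv)
      moreover have "m div n \<le> m" by simp
      ultimately show "i \<in> {i. i < m \<and> Suc i * n \<le> m} \<longleftrightarrow> i \<in> {..<m div n}"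
        by (simp only: mem_Collect_eq lessThan_iff) linarith
    qed
    then show ?thesis by simp
  qed
  also have "\<dots> = (\<Sum>i<m. if Suc i * n \<le> m then 1 else 0)"
    by (rule card_less_eq_sum)
  also have "\<dots> = (\<Sum>i<m. (1 - (Suc i * n - m)) * (1 - (1 - n)))"
    using False by (intro sum.cong) auto
  finally show ?thesis .
qed simp

lemma total_recursive_div:
  assumes "total_recursive k f" "total_recursive k g"
  shows "total_recursive k (\<lambda>xs. f xs div g xs)"
  unfolding div_eq_sum
  by (intro total_recursive_sum total_recursive_mult total_recursive_diff
      assms assms[THEN total_recursive_tl] total_recursive_basic) auto

lemma total_recursive_mod:
  assumes "total_recursive k f" "total_recursive k g"
  shows "total_recursive k (\<lambda>xs. f xs mod g xs)"
proof -
  have "total_recursive k (\<lambda>xs. f xs - g xs * (f xs div g xs))"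
    by (intro total_recursive_diff total_recursive_mult total_recursive_div assms)
  then show ?thesis by (simp add: minus_mult_div_eq_mod)
qed

definition triangle_root :: "nat \<Rightarrow> nat" where
  "triangle_root z = (\<Sum>i<z. 1 - (Suc i * Suc (Suc i) div 2 - z))"

lemma triangle_mono: "m \<le> n \<Longrightarrow> triangle m \<le> triangle n"
  unfolding triangle_def by (intro div_le_mono mult_le_mono) auto

lemma triangle_root_prod_encode: "triangle_root (prod_encode (m, n)) = m + n"
proof -
  let ?z = "triangle (m + n) + m"
  have iff: "triangle (Suc i) \<le> ?z \<longleftrightarrow> i < m + n" for i
  proof
    assume "i < m + n"
    then show "triangle (Suc i) \<le> ?z"
      using triangle_mono[of "Suc i" "m + n"] by linarith
  next
    assume le: "triangle (Suc i) \<le> ?z"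
    show "i < m + n"
    proof (rule ccontr)
      assume "\<not> i < m + n"
      then have "triangle (Suc (m + n)) \<le> triangle (Suc i)" by (intro triangle_mono) simp
      with le show False by simp
    qed
  qed
  have "k \<le> triangle k" for k by (induction k) auto
  then have le: "m + n \<le> ?z" by (simp add: trans_le_add1)
  have "{i. i < ?z \<and> triangle (Suc i) \<le> ?z} = {..<m + n}"
    unfolding iff using le by auto
  then have "m + n = card {i. i < ?z \<and> triangle (Suc i) \<le> ?z}" by (simp only: card_lessThan)
  also have "\<dots> = (\<Sum>i<?z. if triangle (Suc i) \<le> ?z then 1 else 0)"
    by (rule card_less_eq_sum)
  also have "\<dots> = (\<Sum>i<?z. 1 - (triangle (Suc i) - ?z))"
    by (intro sum.cong refl) (simp split: if_split del: triangle_Suc)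
  finally show ?thesis
    by (simp only: triangle_root_def triangle_def prod_encode_def prod.case)
qed

lemma prod_decode_eq_triangle_root:
  "fst (prod_decode z) = z - triangle_root z * Suc (triangle_root z) div 2"
  "snd (prod_decode z) = triangle_root z - (z - triangle_root z * Suc (triangle_root z) div 2)"
proof -
  obtain m n where "prod_decode z = (m, n)" by (cases "prod_decode z")
  then have z: "z = prod_encode (m, n)" by (metis prod_decode_inverse)
  show "fst (prod_decode z) = z - triangle_root z * Suc (triangle_root z) div 2"
    "snd (prod_decode z) = triangle_root z - (z - triangle_root z * Suc (triangle_root z) div 2)"
    unfolding z triangle_root_prod_encode triangle_def[symmetric] prod_encode_inverse
    by (simp_all add: prod_encode_def)
qed

lemmas total_recursive_arith =
  total_recursive_sum total_recursive_add total_recursive_diff total_recursive_mult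
  total_recursive_power total_recursive_fact total_recursive_div total_recursive_mod

lemma total_recursive_triangle_root:
  assumes "total_recursive k f"
  shows "total_recursive k (\<lambda>xs. triangle_root (f xs))"
  unfolding triangle_root_def
  by (intro total_recursive_arith assms total_recursive_tl[OF assms] total_recursive_basic) auto

lemma total_recursive_prod_decode:
  assumes "total_recursive k f"
  shows "total_recursive k (\<lambda>xs. fst (prod_decode (f xs)))"
    "total_recursive k (\<lambda>xs. snd (prod_decode (f xs)))"
  unfolding prod_decode_eq_triangle_root
  by (intro total_recursive_arith total_recursive_triangle_root assms total_recursive_basic)+

definition code_nth :: "nat \<Rightarrow> nat \<Rightarrow> nat" where
  "code_nth c i = fst (prod_decode (((\<lambda>c. snd (prod_decode (c - 1))) ^^ i) c - 1))"

lemma code_nth_list_encode: "i < length xs \<Longrightarrow> code_nth (list_encode xs) i = xs ! i"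
proof (induction xs arbitrary: i)
  case (Cons x xs)
  show ?case
  proof (cases i)
    case (Suc j)
    have "code_nth (list_encode (x # xs)) (Suc j) = code_nth (list_encode xs) j"
      by (simp add: code_nth_def funpow_Suc_right del: funpow.simps)
    then show ?thesis using Cons Suc by simp
  qed (simp add: code_nth_def)
qed simp

lemma total_recursive_code_nth:
  assumes "total_recursive k f" "total_recursive k g"
  shows "total_recursive k (\<lambda>xs. code_nth (f xs) (g xs))"
  unfolding code_nth_def
  by (intro total_recursive_prod_decode total_recursive_arith assms total_recursive_basic
     total_recursive_funpow[of k g f "\<lambda>y _. snd (prod_decode (y - 1))"]) auto

section \<open>Simulation on words\<close>

text \<open>
  Words are numerals to base \<open>n\<close> whose lowest digit is the leftmost cell. The digits of \<open>w\<close> from \<open>i\<close> to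
  \<open>i + 2 * r\<close> then form the number \<open>w div n ^ i mod n ^ (2 * r + 1)\<close>, which is the position of the
  corresponding neighbourhood in \<^const>\<open>rule_table\<close>. Cell \<open>i\<close> of the image word is the new state of
  cell \<open>i + r\<close>, and its right end is padded with junk computed from zero digits, so that after \<open>t\<close>
  steps only the digits \<open>i\<close> with \<open>i + 2 * r * t < L\<close> are meaningful.
\<close>

definition digit :: "nat \<Rightarrow> nat \<Rightarrow> nat \<Rightarrow> nat" where
  "digit n w i = w div n ^ i mod n"

definition ca_word :: "nat \<Rightarrow> nat \<Rightarrow> (nat \<Rightarrow> nat) \<Rightarrow> nat \<Rightarrow> nat \<Rightarrow> nat" where
  "ca_word n r T L w = (\<Sum>i<L. T (w div n ^ i mod n ^ (2 * r + 1)) * n ^ i)"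

lemma digit_less: "0 < n \<Longrightarrow> digit n w i < n"
  by (simp add: digit_def)

lemma sum_digits_less:
  fixes n :: nat
  assumes "\<And>i. i < L \<Longrightarrow> v i < n"
  shows "(\<Sum>i<L. v i * n ^ i) < n ^ L"
  using assms
proof (induction L)
  case (Suc L)
  have "v L * n ^ L + n ^ L \<le> n * n ^ L"
    using mult_le_mono1[of "Suc (v L)" n "n ^ L"] Suc.prems[of L] by simp
  with Suc.IH Suc.prems show ?case by simp
qed simp

lemma digit_sum_digits:
  assumes "\<And>i. i < L \<Longrightarrow> v i < n" "j < L"
  shows "digit n (\<Sum>i<L. v i * n ^ i) j = v j"
  using assms
proof (induction L)
  case (Suc L)
  have n: "0 < n" using Suc.prems(1)[of L] by simp
  show ?case
  proof (cases "j < L")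
    case True
    then obtain d where "L = Suc (j + d)" by (auto dest: less_imp_Suc_add)
    then have L: "v L * n ^ L = (v L * n ^ d * n) * n ^ j" by (simp add: power_add)
    have "(S + v L * n ^ L) div n ^ j mod n = S div n ^ j mod n" for S
      unfolding L using n by (subst div_mult_self1) simp_all
    then show ?thesis using Suc True by (simp add: digit_def)
  next
    case False
    then have "j = L" using Suc.prems(2) by simp
    then show ?thesis
      using sum_digits_less[of L v n] Suc.prems(1) n by (simp add: digit_def)
  qed
qed simp

lemma digit_mod_power:
  assumes "j < m"
  shows "digit n (w mod n ^ m) j = digit n w j"
proof (cases "n = 0")
  case False
  have "w mod n ^ m = w mod (n ^ j * n ^ (m - j))"
    using assms by (simp flip: power_add)
  then have "w mod n ^ m div n ^ j = w div n ^ j mod n ^ (m - j)"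
    using False by (simp add: mod_mult2_eq)
  moreover have "n dvd n ^ (m - j)" using assms by simp
  ultimately show ?thesis by (simp add: digit_def mod_mod_cancel)
qed (use assms in \<open>simp add: digit_def power_0_left\<close>)

lemma digit_div_power: "digit n (w div n ^ i) j = digit n w (i + j)"
  by (simp add: digit_def power_add div_mult2_eq)

lemma length_n_lists_upt: "length (List.n_lists m [0..<n]) = n ^ m"
  by (simp add: length_n_lists)

lemma n_lists_nth:
  assumes "v < n ^ m"
  shows "List.n_lists m [0..<n] ! v = map (digit n v) [0..<m]"
  using assms
proof (induction m arbitrary: v)
  case (Suc m)
  have block: "concat (map (\<lambda>ys. map (\<lambda>y. y # ys) [0..<n]) yss) ! w = (w mod n) # yss ! (w div n)"
    if "w < n * length yss" for w and yss :: "nat list list"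
    using that
  proof (induction yss arbitrary: w)
    case (Cons ys yss)
    then have n: "0 < n" by (cases n) auto
    show ?case
    proof (cases "w < n")
      case False
      then have "w div n = Suc ((w - n) div n)" "w mod n = (w - n) mod n"
        using n by (simp_all add: le_div_geq le_mod_geq)
      then show ?thesis using Cons False by (simp add: nth_append)
    qed (simp add: nth_append)
  qed simp
  have lt: "v div n < n ^ m"
    using Suc.prems by (metis less_mult_imp_div_less mult.commute power_Suc)
  have "List.n_lists (Suc m) [0..<n] ! v = (v mod n) # map (digit n (v div n)) [0..<m]"
    using Suc.prems by (simp add: block length_n_lists_upt Suc.IH[OF lt] del: upt_Suc)
  also have "\<dots> = map (digit n v) [0..<Suc m]"
    by (simp add: map_upt_Suc digit_def div_mult2_eq del: upt_Suc)
  finally show ?case .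
qed simp

lemma rule_table_nth:
  assumes "v < n ^ (2 * r + 1)"
  shows "rule_table n r \<delta> ! v = \<delta> (map (digit n v) [0..<2 * r + 1])"
  using assms n_lists_nth[OF assms] by (simp only: rule_table_def nth_map length_n_lists_upt)

lemma map_upto_window: "map c [i - int r..i + int r] = map (\<lambda>j. c (i - int r + int j)) [0..<2 * r + 1]"
  by (intro nth_equalityI) (auto simp del: upt_Suc)

lemma digit_ca_word:
  assumes n: "0 < n" and \<delta>: "\<delta> \<in> local_rules {..<n} r"
    and T: "\<And>v. v < n ^ (2 * r + 1) \<Longrightarrow> T v = rule_table n r \<delta> ! v"
    and c: "\<And>i. i < M \<Longrightarrow> c (a + int i) = digit n w i"
    and "i + 2 * r < M" "i < L"
  shows "digit n (ca_word n r T L w) i = ca_map r \<delta> c (a + int r + int i)"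
proof -
  have T': "T (w div n ^ i mod n ^ (2 * r + 1)) = \<delta> (map (\<lambda>j. digit n w (i + j)) [0..<2 * r + 1])" for i
  proof -
    have "map (digit n (w div n ^ i mod n ^ (2 * r + 1))) [0..<2 * r + 1] =
        map (\<lambda>j. digit n w (i + j)) [0..<2 * r + 1]"
      by (intro map_cong refl) (simp only: set_upt atLeastLessThan_iff digit_mod_power digit_div_power)
    then show ?thesis
      using n by (simp only: T rule_table_nth mod_less_divisor zero_less_power)
  qed
  have "\<delta> (map (\<lambda>j. digit n w (i + j)) [0..<2 * r + 1]) < n" for i
  proof -
    have "map (\<lambda>j. digit n w (i + j)) [0..<2 * r + 1] \<in> {xs. set xs \<subseteq> {..<n} \<and> length xs = 2 * r + 1}"
      using n by (auto simp: digit_less simp del: upt_Suc)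
    with \<delta> show ?thesis unfolding local_rules_def by blast
  qed
  then have "digit n (ca_word n r T L w) i = T (w div n ^ i mod n ^ (2 * r + 1))"
    unfolding ca_word_def using assms(6) by (subst digit_sum_digits) (simp_all only: T')
  also have "\<dots> = \<delta> (map (\<lambda>j. digit n w (i + j)) [0..<2 * r + 1])"
    by (rule T')
  also have "\<dots> = \<delta> (map (\<lambda>j. c (a + int r + int i - int r + int j)) [0..<2 * r + 1])"
  proof -
    have "digit n w (i + j) = c (a + int r + int i - int r + int j)" if "j < 2 * r + 1" for j
      using c[of "i + j"] that assms(5) by (simp add: algebra_simps)
    then show ?thesis by (metis (mono_tags, lifting) map_cong atLeastLessThan_iff set_upt)
  qed
  finally show ?thesis by (simp only: ca_map_def map_upto_window)
qed

lemma digit_ca_word_funpow: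
  assumes n: "0 < n" and \<delta>: "\<delta> \<in> local_rules {..<n} r"
    and T: "\<And>v. v < n ^ (2 * r + 1) \<Longrightarrow> T v = rule_table n r \<delta> ! v"
    and c: "\<And>i. i < L \<Longrightarrow> c (a + int i) = digit n w i"
    and "i + 2 * r * t < L"
  shows "digit n ((ca_word n r T L ^^ t) w) i = (ca_map r \<delta> ^^ t) c (a + int (r * t) + int i)"
  using assms(5)
proof (induction t arbitrary: i)
  case 0
  then show ?case by (simp add: c)
next
  case (Suc t)
  have "digit n (ca_word n r T L ((ca_word n r T L ^^ t) w)) i =
      ca_map r \<delta> ((ca_map r \<delta> ^^ t) c) (a + int (r * t) + int r + int i)"
    by (rule digit_ca_word[OF n \<delta> T, where M = "L - 2 * r * t"])
      (use Suc in \<open>auto simp: algebra_simps\<close>)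
  then show ?case by (simp add: algebra_simps)
qed

lemma ca_map_funpow_eq_iff_words:
  assumes n: "0 < n" and \<delta>: "\<delta> \<in> local_rules {..<n} r"
    and T: "\<And>v. v < n ^ (2 * r + 1) \<Longrightarrow> T v = rule_table n r \<delta> ! v"
    and L: "L = 2 * r * (N + p) + 1"
  shows "(\<forall>c\<in>configs {..<n}. (ca_map r \<delta> ^^ (N + p)) c = (ca_map r \<delta> ^^ N) c) \<longleftrightarrow>
    (\<forall>w<n ^ L. digit n ((ca_word n r T L ^^ (N + p)) w) 0 = digit n ((ca_word n r T L ^^ N) w) (r * p))"
    (is "?lhs \<longleftrightarrow> ?rhs")
proof -
  have sim: "digit n ((ca_word n r T L ^^ t) w) i = (ca_map r \<delta> ^^ t) c (a + int (r * t) + int i)"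
    if "\<And>i. i < L \<Longrightarrow> c (a + int i) = digit n w i" "i + 2 * r * t < L" for c a w i t
    using n \<delta> T that by (rule digit_ca_word_funpow)
  show ?thesis
  proof (intro iffI allI impI ballI ext)
    fix w assume lhs: ?lhs and "w < n ^ L"
    define c where "c i = digit n w (nat i)" for i
    have "c \<in> configs {..<n}" by (simp add: configs_iff c_def digit_less n)
    with lhs have "(ca_map r \<delta> ^^ (N + p)) c = (ca_map r \<delta> ^^ N) c" by blast
    then show "digit n ((ca_word n r T L ^^ (N + p)) w) 0 = digit n ((ca_word n r T L ^^ N) w) (r * p)"
      using sim[of c 0 w 0 "N + p"] sim[of c 0 w "r * p" N]
      by (simp add: c_def L algebra_simps)
  next
    fix c i assume rhs: ?rhs and c: "c \<in> configs {..<n}"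
    let ?a = "i - int (r * (N + p))"
    let ?w = "\<Sum>j<L. c (?a + int j) * n ^ j"
    have lt: "c j < n" for j using c by (simp add: configs_iff)
    have w: "c (?a + int j) = digit n ?w j" if "j < L" for j
      using that lt by (simp add: digit_sum_digits)
    have "digit n ((ca_word n r T L ^^ (N + p)) ?w) 0 = digit n ((ca_word n r T L ^^ N) ?w) (r * p)"
      using rhs sum_digits_less[of L "\<lambda>j. c (?a + int j)" n] lt by blast
    then show "(ca_map r \<delta> ^^ (N + p)) c i = (ca_map r \<delta> ^^ N) c i"
      using sim[of c ?a ?w 0 "N + p", OF w] sim[of c ?a ?w "r * p" N, OF w]
      by (simp add: L algebra_simps)
  qed
qed

section \<open>Equicontinuity and sensitivity\<close>

lemma local_radius_ca_map: "local_radius S (ca_map r \<delta>) r"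
  unfolding local_radius_def ca_map_def
  by (intro ballI allI impI arg_cong[where f = \<delta>] map_cong refl) auto

lemma config_endo_ca_map:
  assumes "additive_ca G r \<delta>"
  shows "config_endo G (ca_map r \<delta>)"
proof -
  interpret comm_group G using assms by (simp add: additive_ca_def)
  let ?C = "configs (carrier G)" and ?F = "ca_map r \<delta>"
  have hom: "?F \<in> hom (config_group G) (config_group G)"
    using assms by (simp add: additive_ca_def)
  have closed: "?F c \<in> ?C" if "c \<in> ?C" for c
    using hom_in_carrier[OF hom] that by (simp add: carrier_config_group)
  have mult: "?F (\<lambda>i. c i \<otimes>\<^bsub>G\<^esub> d i) = (\<lambda>i. ?F c i \<otimes>\<^bsub>G\<^esub> ?F d i)"
    if "c \<in> ?C" "d \<in> ?C" for c d
    using hom_mult[OF hom, of c d] that unfolding carrier_config_group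
    by (simp add: config_group_def restrict_UNIV)
  show ?thesis
  proof unfold_locales
    fix c d assume c: "c \<in> ?C" and d: "d \<in> ?C"
    define e where "e = (\<lambda>i. c i \<otimes>\<^bsub>G\<^esub> inv\<^bsub>G\<^esub> d i)"
    have e: "e \<in> ?C" using c d by (simp add: e_def configs_iff)
    have "c = (\<lambda>i. e i \<otimes>\<^bsub>G\<^esub> d i)"
      using c d by (simp add: e_def configs_iff m_assoc)
    then have "?F c = (\<lambda>i. ?F e i \<otimes>\<^bsub>G\<^esub> ?F d i)"
      using mult[OF e d] by simp
    then show "?F e = (\<lambda>i. ?F c i \<otimes>\<^bsub>G\<^esub> inv\<^bsub>G\<^esub> ?F d i)"
      using closed[OF e] closed[OF d] by (simp add: configs_iff m_assoc)
  next
    fix c s assume "c \<in> ?C"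
    show "?F (\<lambda>i. c (i + s)) = (\<lambda>i. ?F c (i + s))"
      unfolding ca_map_def map_upto_window by (simp add: algebra_simps)
  qed (rule closed)
qed

lemma config_dist_less_if_agree:
  assumes "\<And>i. \<bar>i\<bar> \<le> int R \<Longrightarrow> c i = d i"
  shows "config_dist c d < (1 / 2) ^ R"
proof (cases "c = d")
  case False
  let ?P = "\<lambda>i::nat. c (int i) \<noteq> d (int i) \<or> c (- int i) \<noteq> d (- int i)"
  obtain i where "c i \<noteq> d i" using False by blast
  then have "?P (nat \<bar>i\<bar>)" by (cases "0 \<le> i") auto
  then have "?P (Least ?P)" by (rule LeastI)
  then have "\<not> Least ?P \<le> R" using assms[of "int (Least ?P)"] assms[of "- int (Least ?P)"] by auto
  then have "(1 / 2 :: real) ^ Least ?P < (1 / 2) ^ R"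
    by (intro power_strict_decreasing) auto
  then show ?thesis using False by (simp add: config_dist_def)
qed (simp add: config_dist_def)

lemma agree_if_config_dist_less:
  assumes "config_dist c d < (1 / 2) ^ R" "\<bar>i\<bar> \<le> int R"
  shows "c i = d i"
proof (rule ccontr)
  let ?P = "\<lambda>i::nat. c (int i) \<noteq> d (int i) \<or> c (- int i) \<noteq> d (- int i)"
  assume neq: "c i \<noteq> d i"
  then have "?P (nat \<bar>i\<bar>)" by (cases "0 \<le> i") auto
  then have "Least ?P \<le> nat \<bar>i\<bar>" by (rule Least_le)
  also have "\<dots> \<le> R" using assms(2) by simp
  finally have "(1 / 2 :: real) ^ R \<le> (1 / 2) ^ Least ?P"
    by (intro power_decreasing) auto
  moreover have "config_dist c d = (1 / 2) ^ Least ?P"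
    using neq unfolding config_dist_def by (intro if_not_P) blast
  ultimately show False using assms(1) by linarith
qed

lemma config_dist_commute: "config_dist c d = config_dist d c"
  by (auto simp: config_dist_def eq_commute)

lemma config_dist_pos: "c \<noteq> d \<Longrightarrow> 0 < config_dist c d"
  by (simp add: config_dist_def)

lemma half_power_less:
  fixes \<epsilon> :: real
  assumes "0 < \<epsilon>"
  obtains R where "(1 / 2) ^ R < \<epsilon>"
  using real_arch_pow_inv[OF assms, of "1 / 2"] by auto

lemma not_sensitive_if_equicontinuous:
  assumes "X \<noteq> {}" "\<And>x y. d x y = d y x" "equicontinuous X d F"
  shows "\<not> sensitive X d F"
proof
  assume "sensitive X d F"
  then obtain \<epsilon> where \<epsilon>: "\<epsilon> > 0" and
    sens: "\<And>x \<eta>. x \<in> X \<Longrightarrow> \<eta> > 0 \<Longrightarrow> \<exists>y\<in>X. d y x < \<eta> \<and> (\<exists>k. d ((F ^^ k) y) ((F ^^ k) x) > \<epsilon>)"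
    unfolding sensitive_def by blast
  obtain \<eta> where "\<eta> > 0"
    and "\<And>x y k. x \<in> X \<Longrightarrow> y \<in> X \<Longrightarrow> d x y < \<eta> \<Longrightarrow> d ((F ^^ k) x) ((F ^^ k) y) < \<epsilon>"
    using assms(3) \<epsilon> unfolding equicontinuous_def by blast
  then show False using sens assms(1) by (metis ex_in_conv not_less_iff_gr_or_eq)
qed

lemma equicontinuous_if_bounded_radius:
  assumes "\<And>k. local_radius S (F ^^ k) R"
  shows "equicontinuous (configs S) config_dist F"
  unfolding equicontinuous_def
proof (intro allI impI)
  fix \<epsilon> :: real assume "\<epsilon> > 0"
  then obtain l where l: "(1 / 2) ^ l < \<epsilon>" by (rule half_power_less)
  show "\<exists>\<eta>>0. \<forall>x\<in>configs S. \<forall>y\<in>configs S. config_dist x y < \<eta> \<longrightarrow>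
      (\<forall>k. config_dist ((F ^^ k) x) ((F ^^ k) y) < \<epsilon>)"
  proof (intro exI[of _ "(1 / 2) ^ (l + R)"] conjI ballI impI allI)
    fix c d k
    assume c: "c \<in> configs S" and d: "d \<in> configs S" and "config_dist c d < (1 / 2) ^ (l + R)"
    then have agree: "c i = d i" if "\<bar>i\<bar> \<le> int (l + R)" for i
      using that by (intro agree_if_config_dist_less)
    have "config_dist ((F ^^ k) c) ((F ^^ k) d) < (1 / 2) ^ l"
    proof (rule config_dist_less_if_agree)
      fix i assume "\<bar>i\<bar> \<le> int l"
      then show "(F ^^ k) c i = (F ^^ k) d i"
        by (intro local_radiusD[OF assms c d] agree) auto
    qed
    then show "config_dist ((F ^^ k) c) ((F ^^ k) d) < \<epsilon>" using l by simp
  qed simp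
qed

lemma (in config_endo) sensitive_if_unbounded_radius:
  assumes unbounded: "\<And>R. \<exists>k. \<not> local_radius (carrier G) (H ^^ k) R"
  shows "sensitive C config_dist H"
  unfolding sensitive_def
proof (intro exI[of _ "1 / 2 :: real"] conjI ballI allI impI)
  fix x and \<eta> :: real assume x: "x \<in> C" and "\<eta> > 0"
  then obtain R where R: "(1 / 2) ^ R < \<eta>" by (elim half_power_less)
  obtain k c d i where c: "c \<in> C" and d: "d \<in> C"
    and agree: "\<And>j. \<bar>j - i\<bar> \<le> int R \<Longrightarrow> c j = d j" and neq: "(H ^^ k) c i \<noteq> (H ^^ k) d i"
    using unbounded[of R] unfolding local_radius_def by blast
  interpret K: config_endo G "H ^^ k" by (rule funpow_endo)
  define e where "e = (\<lambda>j. d (j + i) \<otimes> inv c (j + i))"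
  define y where "y = (\<lambda>j. x j \<otimes> inv e j)"
  have e: "e \<in> C" unfolding e_def by (intro diff_closed shift_closed c d)
  have y: "y \<in> C" unfolding y_def by (intro diff_closed x e)
  have Hk: "(H ^^ k) e = (\<lambda>j. (H ^^ k) d (j + i) \<otimes> inv (H ^^ k) c (j + i))"
    unfolding e_def by (simp add: K.H_diff K.H_shift shift_closed c d)
  have mem: "(H ^^ k) c j \<in> carrier G" "(H ^^ k) d j \<in> carrier G" "(H ^^ k) x j \<in> carrier G"
    "(H ^^ k) e j \<in> carrier G" "c j \<in> carrier G" "d j \<in> carrier G" "x j \<in> carrier G" for j
    using c d x e K.H_closed[OF c] K.H_closed[OF d] K.H_closed[OF x] K.H_closed[OF e]
    by (simp_all add: configs_iff)
  have "(H ^^ k) e 0 \<noteq> \<one>"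
    using neq eq_if_diff_one[OF mem(2,1), of i i] by (auto simp: Hk)
  moreover have "(H ^^ k) y 0 = (H ^^ k) x 0 \<otimes> inv (H ^^ k) e 0"
    unfolding y_def by (simp add: K.H_diff x e)
  ultimately have neq0: "(H ^^ k) y 0 \<noteq> (H ^^ k) x 0"
    using mem by (simp add: r_cancel_one inv_eq_1_iff)
  then have "y \<noteq> x" by blast
  have "config_dist y x < (1 / 2) ^ R"
  proof (rule config_dist_less_if_agree)
    fix j :: int assume "\<bar>j\<bar> \<le> int R"
    then show "y j = x j" using agree[of "j + i"] mem by (simp add: y_def e_def)
  qed
  moreover have "config_dist ((H ^^ k) y) ((H ^^ k) x) > 1 / 2"
    using agree_if_config_dist_less[of "(H ^^ k) y" "(H ^^ k) x" 0 0] neq0 by force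
  ultimately show "\<exists>y\<in>C. 0 < config_dist y x \<and> config_dist y x < \<eta> \<and>
      (\<exists>k. config_dist ((H ^^ k) y) ((H ^^ k) x) > 1 / 2)"
    using y R config_dist_pos[OF \<open>y \<noteq> x\<close>] by (intro bexI[of _ y]) auto
qed simp

lemma (in config_endo) dichotomy:
  "equicontinuous C config_dist H \<longleftrightarrow> (\<exists>R. \<forall>k. local_radius (carrier G) (H ^^ k) R)"
  "sensitive C config_dist H \<longleftrightarrow> \<not> (\<exists>R. \<forall>k. local_radius (carrier G) (H ^^ k) R)"
proof -
  have "C \<noteq> {}" using one_config_closed by blast
  from not_sensitive_if_equicontinuous[where d = config_dist and F = H, OF this config_dist_commute]
  have "\<not> sensitive C config_dist H" if "equicontinuous C config_dist H"
    using that by blast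
  moreover have "equicontinuous C config_dist H" if "\<exists>R. \<forall>k. local_radius (carrier G) (H ^^ k) R"
    using that equicontinuous_if_bounded_radius[where S = "carrier G" and F = H] by blast
  moreover have "sensitive C config_dist H" if "\<nexists>R. \<forall>k. local_radius (carrier G) (H ^^ k) R"
    using that sensitive_if_unbounded_radius by blast
  ultimately show "equicontinuous C config_dist H \<longleftrightarrow> (\<exists>R. \<forall>k. local_radius (carrier G) (H ^^ k) R)"
    "sensitive C config_dist H \<longleftrightarrow> \<not> (\<exists>R. \<forall>k. local_radius (carrier G) (H ^^ k) R)"
    by blast+
qed

lemma (in config_endo) bounded_radius_iff_periodic:
  assumes "finite (carrier G)" "local_radius (carrier G) H R"
    and "N = order G ^ (order G ^ order G * order G)"
  shows "(\<exists>R. \<forall>k. local_radius (carrier G) (H ^^ k) R) \<longleftrightarrow>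
    (\<forall>c\<in>C. (H ^^ (N + fact N)) c = (H ^^ N) c)"
proof
  assume "\<forall>c\<in>C. (H ^^ (N + fact N)) c = (H ^^ N) c"
  then show "\<exists>R. \<forall>k. local_radius (carrier G) (H ^^ k) R"
    using bounded_radius_if_periodic[OF assms(2), of "fact N" N] by auto
qed (use funpow_periodic_if_bounded_radius[OF assms(1) _ assms(3)] in blast)

section \<open>The decision procedure\<close>

lemma total_recursive_digit:
  assumes "total_recursive k n" "total_recursive k w" "total_recursive k i"
  shows "total_recursive k (\<lambda>xs. digit (n xs) (w xs) (i xs))"
  unfolding digit_def by (intro total_recursive_arith assms)

lemma total_recursive_ca_word:
  assumes "total_recursive k n" "total_recursive k r" "total_recursive k c"
    "total_recursive k L" "total_recursive k w"
  shows "total_recursive k (\<lambda>xs. ca_word (n xs) (r xs) (code_nth (c xs)) (L xs) (w xs))"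
  unfolding ca_word_def
  by (intro total_recursive_arith total_recursive_code_nth assms assms[THEN total_recursive_tl]
      total_recursive_hd total_recursive_const) simp_all

lemma total_recursive_ca_word_funpow:
  assumes "total_recursive k n" "total_recursive k r" "total_recursive k c"
    "total_recursive k L" "total_recursive k w" "total_recursive k t"
  shows "total_recursive k (\<lambda>xs. (ca_word (n xs) (r xs) (code_nth (c xs)) (L xs) ^^ t xs) (w xs))"
  by (intro total_recursive_funpow[of k t w "\<lambda>w xs. ca_word (n xs) (r xs) (code_nth (c xs)) (L xs) w"]
      total_recursive_ca_word assms assms[THEN total_recursive_tl] total_recursive_hd) simp

definition periodicity_test :: "nat \<Rightarrow> nat \<Rightarrow> nat \<Rightarrow> nat \<Rightarrow> nat \<Rightarrow> nat \<Rightarrow> nat" where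
  "periodicity_test n r c N p L = 1 - (\<Sum>w<n ^ L.
     (digit n ((ca_word n r (code_nth c) L ^^ (N + p)) w) 0 -
      digit n ((ca_word n r (code_nth c) L ^^ N) w) (r * p)) +
     (digit n ((ca_word n r (code_nth c) L ^^ N) w) (r * p) -
      digit n ((ca_word n r (code_nth c) L ^^ (N + p)) w) 0))"

lemma periodicity_test_eq:
  "periodicity_test n r c N p L =
    (if \<forall>w<n ^ L. digit n ((ca_word n r (code_nth c) L ^^ (N + p)) w) 0 =
        digit n ((ca_word n r (code_nth c) L ^^ N) w) (r * p) then 1 else 0)"
proof -
  have "(\<Sum>w<m. (f w - g w) + (g w - f w)) = 0 \<longleftrightarrow> (\<forall>w<m. f w = g w)" for m and f g :: "nat \<Rightarrow> nat"
    by (auto intro: antisym)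
  moreover have "1 - s = (if s = 0 then 1 else 0)" for s :: nat by simp
  ultimately show ?thesis unfolding periodicity_test_def by presburger
qed

lemma total_recursive_periodicity_test:
  assumes "total_recursive k n" "total_recursive k r" "total_recursive k c"
    "total_recursive k N" "total_recursive k p" "total_recursive k L"
  shows "total_recursive k (\<lambda>xs. periodicity_test (n xs) (r xs) (c xs) (N xs) (p xs) (L xs))"
  unfolding periodicity_test_def
  by (intro total_recursive_arith total_recursive_digit total_recursive_ca_word_funpow assms
      assms[THEN total_recursive_tl] total_recursive_hd total_recursive_const) simp_all

definition ca_decider :: "nat list \<Rightarrow> nat" where
  "ca_decider xs =
    (let n = xs ! 0; r = xs ! 2; N = n ^ (n ^ n * n)
     in periodicity_test n r (xs ! 3) N (fact N) (2 * r * (N + fact N) + 1))"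

lemma total_recursive_ca_decider: "total_recursive 4 ca_decider"
proof -
  have "total_recursive 4 (\<lambda>xs. ca_decider xs)"
    unfolding ca_decider_def Let_def
    by (intro total_recursive_periodicity_test total_recursive_arith total_recursive_nth
        total_recursive_const) simp_all
  then show ?thesis by simp
qed

lemma ca_decider_correct:
  assumes "(G, r, \<delta>) \<in> additive_ca_inputs"
  shows "ca_decider (encode_ca (G, r, \<delta>)) =
    (if \<exists>R. \<forall>k. local_radius (carrier G) (ca_map r \<delta> ^^ k) R then 1 else 0)"
proof -
  have carrier: "carrier G = {..<order G}" and ca: "additive_ca G r \<delta>"
    using assms by (auto simp: additive_ca_inputs_def)
  interpret config_endo G "ca_map r \<delta>" by (rule config_endo_ca_map[OF ca])
  have fin: "finite (carrier G)" and \<delta>: "\<delta> \<in> local_rules {..<order G} r"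
    using ca carrier by (auto simp: additive_ca_def)
  define n where "n = order G"
  have n: "0 < n" using fin by (simp add: n_def order_gt_0_iff_finite)
  define N where "N = n ^ (n ^ n * n)"
  let ?T = "code_nth (list_encode (rule_table n r \<delta>))"
  have T: "?T v = rule_table n r \<delta> ! v" if "v < n ^ (2 * r + 1)" for v
    using that by (simp add: code_nth_list_encode rule_table_def length_n_lists_upt del: List.n_lists.simps)
  have "(\<exists>R. \<forall>k. local_radius (carrier G) (ca_map r \<delta> ^^ k) R) \<longleftrightarrow>
    (\<forall>c\<in>C. (ca_map r \<delta> ^^ (N + fact N)) c = (ca_map r \<delta> ^^ N) c)"
    by (rule bounded_radius_iff_periodic[OF fin local_radius_ca_map]) (simp add: N_def n_def)
  also have "C = configs {..<n}" using carrier by (simp add: n_def)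
  also note ca_map_funpow_eq_iff_words[OF n \<delta>[folded n_def] T refl]
  finally show ?thesis
    by (simp only: ca_decider_def encode_ca_def Let_def prod.case periodicity_test_eq)
      (simp add: N_def n_def)
qed

lemma decidable_on_if_total_recursive:
  assumes "total_recursive k f" "\<And>x. x \<in> D \<Longrightarrow> length (enc x) = k"
    and "\<And>x. x \<in> D \<Longrightarrow> f (enc x) = (if P x then 1 else 0)"
  shows "decidable_on D enc P"
  using assms unfolding total_recursive_def decidable_on_def by metis

theorem corollary2p21:
  shows "decidable_on additive_ca_inputs encode_ca
           (\<lambda>(G, r, \<delta>). equicontinuous (configs (carrier G)) config_dist (ca_map r \<delta>)) \<and>
         decidable_on additive_ca_inputs encode_ca
           (\<lambda>(G, r, \<delta>). sensitive (configs (carrier G)) config_dist (ca_map r \<delta>))"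
proof
  have ca: "additive_ca G r \<delta>" if "(G, r, \<delta>) \<in> additive_ca_inputs" for G r \<delta>
    using that by (simp add: additive_ca_inputs_def)
  note dichotomy = config_endo.dichotomy[OF config_endo_ca_map[OF ca]]
  have len: "length (encode_ca x) = 4" for x
    by (cases x) (simp add: encode_ca_def)
  show "decidable_on additive_ca_inputs encode_ca
      (\<lambda>(G, r, \<delta>). equicontinuous (configs (carrier G)) config_dist (ca_map r \<delta>))"
    by (rule decidable_on_if_total_recursive[OF total_recursive_ca_decider len])
      (clarsimp simp only: ca_decider_correct dichotomy prod.case split_paired_all)
  have "total_recursive 4 (\<lambda>xs. 1 - ca_decider xs)"
    by (intro total_recursive_diff total_recursive_const total_recursive_ca_decider)
  then show "decidable_on additive_ca_inputs encode_ca
      (\<lambda>(G, r, \<delta>). sensitive (configs (carrier G)) config_dist (ca_map r \<delta>))"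
    by (rule decidable_on_if_total_recursive[OF _ len])
      (clarsimp simp only: ca_decider_correct dichotomy prod.case split_paired_all, simp)
qed

end
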